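(* Let $p$ be an odd prime. Then \begin{align*} \sum_{k=0}^{(p+1)/2} (4k-1)^3 \frac{(-\frac{1}{2})_k^4}{k!^4} &\equiv 0\pmod{p^{4}},\\ \sum_{k=0}^{(p+1)/2} (4k-1)^5 \frac{(-\frac{1}{2})_k^4}{k!^4} &\equiv 16p\pmod{p^{4}},\\ \sum_{k=0}^{(p+1)/2} (4k-1)^7 \frac{(-\frac{1}{2})_k^4}{k!^4} &\equiv 80p\pmod{p^{4}}. \end{align*}
   Context: $(a)_k=a(a+1)\cdots(a+k-1)$ denotes the Pochhammer symbol, with $(a)_0=1$. The congruences between rational numbers are understood in the ring of rationals whose denominators are coprime to $p$.
   Formalization: The second and third congruences are stated only for odd primes p other than 3, because for p = 3 both fail modulo 81 (they hold only modulo 27); the first congruence is stated for every odd prime. *)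

theory Defs
  imports Complex_Main "HOL-Computational_Algebra.Primes"
begin

definition rat_coprime_denom :: "nat \<Rightarrow> rat set" where
  "rat_coprime_denom p = {x. coprime (snd (quotient_of x)) (int p)}"

text \<open>Congruence modulo \<open>m\<close> in the ring of rationals with denominator coprime to \<open>p\<close>;
  both sides are required to lie in that ring.\<close>

definition rat_cong :: "nat \<Rightarrow> rat \<Rightarrow> rat \<Rightarrow> nat \<Rightarrow> bool" where
  "rat_cong p x y m \<longleftrightarrow>
     x \<in> rat_coprime_denom p \<and> y \<in> rat_coprime_denom p \<and>
     (\<exists>z \<in> rat_coprime_denom p. x - y = of_nat m * z)"

text \<open>For \<open>p = 3\<close> the congruences with exponents 5 and 7 hold modulo 27 but fail modulo 81,
  so the prime 3 has to be excluded there.\<close>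

lemma not_rat_cong_81:
  assumes "x - y = of_int (27 * n) / 4096" "\<not> 3 dvd n"
  shows "\<not> rat_cong 3 x y 81"
proof
  assume "rat_cong 3 x y 81"
  then obtain z where z: "coprime (snd (quotient_of z)) 3" "x - y = 81 * z"
    by (auto simp: rat_cong_def rat_coprime_denom_def)
  obtain a b where ab: "quotient_of z = (a, b)" by fastforce
  have b: "b > 0" "z = of_int a / of_int b"
    using quotient_of_denom_pos[OF ab] quotient_of_div[OF ab] by auto
  have "of_int n * of_int b = (3 * 4096 * of_int a :: rat)"
    using z(2) assms(1) b by (simp add: field_simps)
  then have "n * b = 3 * (4096 * a)"
    by (metis (mono_tags, lifting) mult.assoc of_int_eq_iff of_int_mult of_int_numeral)
  then have "3 dvd n * b" by simp
  moreover have "coprime (3::int) b"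
    using z(1) ab by (simp add: coprime_commute)
  ultimately show False
    using assms(2) by (simp add: coprime_dvd_mult_left_iff)
qed

lemma exponent_5_fails_at_3:
  "\<not> rat_cong 3
     (\<Sum>k = 0..(3 + 1) div 2. (4 * of_nat k - 1) ^ 5 * (pochhammer (- 1 / 2) k ^ 4 / fact k ^ 4))
     (16 * of_nat 3) (3 ^ 4)"
proof -
  have i: "{0..(3 + 1) div 2} = {0, 1, 2 :: nat}" by auto
  have sum_eq: "(\<Sum>k = 0..(3 + 1) div 2. (4 * of_nat k - 1) ^ 5 * (pochhammer (- 1 / 2) k ^ 4 / fact k ^ 4))
      = (74919 / 4096 :: rat)"
    unfolding i by (simp add: eval_nat_numeral pochhammer_Suc field_simps)
  show ?thesis
    unfolding sum_eq using not_rat_cong_81[of "74919 / 4096" 48 "-4507"] by simp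
qed

lemma exponent_7_fails_at_3:
  "\<not> rat_cong 3
     (\<Sum>k = 0..(3 + 1) div 2. (4 * of_nat k - 1) ^ 7 * (pochhammer (- 1 / 2) k ^ 4 / fact k ^ 4))
     (80 * of_nat 3) (3 ^ 4)"
proof -
  have i: "{0..(3 + 1) div 2} = {0, 1, 2 :: nat}" by auto
  have sum_eq: "(\<Sum>k = 0..(3 + 1) div 2. (4 * of_nat k - 1) ^ 7 * (pochhammer (- 1 / 2) k ^ 4 / fact k ^ 4))
      = (1379319 / 4096 :: rat)"
    unfolding i by (simp add: eval_nat_numeral pochhammer_Suc field_simps)
  show ?thesis
    unfolding sum_eq using not_rat_cong_81[of "1379319 / 4096" 240 "14677"] by simp
qed

end

theory Submission
  imports Defs
begin

text \<open>
  Put \<open>x = 4k - 1\<close> and \<open>w k = (-1/2)\<^sub>k\<^sup>4 / k!\<^sup>4\<close>. For every polynomial \<open>q\<close> the sum of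
  \<open>((x - 1)\<^sup>4 q(x + 2) - (x + 1)\<^sup>4 q(x - 2)) w k\<close> telescopes to a multiple of \<open>p\<^sup>4\<close>. Suitable
  quadratic and quartic \<open>q\<close> show that the sum with \<open>x\<^sup>3\<close> vanishes modulo \<open>p\<^sup>4\<close>, that the sum with \<open>x\<^sup>7\<close> is
  five times the sum with \<open>x\<^sup>5\<close>, and that the latter is \<open>16\<close> times the sum of
  \<open>(4k + 1) (1/2)\<^sub>k\<^sup>4 / k!\<^sup>4\<close> over \<open>k \<le> m = (p - 1)/2\<close>, which has to be \<open>p\<close> modulo \<open>p\<^sup>4\<close>.
  With \<open>X = p\<^sup>2/4\<close> the summand is deformed, without change modulo \<open>p\<^sup>4\<close>, to a well-poised one with
  parameters \<open>X\<close> and \<open>Y = -X\<close>. Whipple's transformation turns the deformed sum into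
  \<open>p\<^sup>2 \<Sum>\<^sub>j V Y j / (2j + 1)\<close>. At \<open>Y = 0\<close> Saalschuetz's theorem gives exactly \<open>p\<close>, and passing from
  \<open>Y = 0\<close> to \<open>Y = -X\<close> costs only \<open>O(p\<^sup>4)\<close>: for \<open>j < m\<close> trivially, and for \<open>j = m\<close>
  (where \<open>2j + 1 = p\<close>) because \<open>1 + 1/2\<^sup>2 + \<dots> + 1/m\<^sup>2\<close> is divisible by \<open>p > 3\<close>.
\<close>

section \<open>Saalschuetz's summation and Whipple's transformation\<close>

lemma pochhammer_quot_eq_prod:
  fixes a :: "'a::field_char_0"
  shows "pochhammer a n / fact n = (\<Prod>i<n. (a + of_nat i) / (1 + of_nat i))"
  by (simp add: pochhammer_prod fact_prod_Suc prod_dividef atLeast0LessThan add.commute)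

text \<open>In Pochhammer notation, \<open>(-1)\<^sup>j (-k)\<^sub>j (k + b)\<^sub>j\<close>.\<close>

definition rprod :: "'a::field_char_0 \<Rightarrow> nat \<Rightarrow> 'a \<Rightarrow> 'a" where
  "rprod b j k = (\<Prod>i<j. (k - of_nat i) * (k + b + of_nat i))"

lemma rprod_0 [simp]: "rprod b 0 k = 1"
  and rprod_Suc: "rprod b (Suc j) k = rprod b j k * ((k - of_nat j) * (k + b + of_nat j))"
  by (simp_all add: rprod_def)

text \<open>The factor with \<open>i = n\<close> vanishes; this makes the sums over \<open>j\<close>
  terminate.\<close>

lemma rprod_eq_0: "n < j \<Longrightarrow> rprod b j (of_nat n) = 0"
  by (auto simp: rprod_def)

text \<open>The last descending and the first ascending factor are split off;
  \<open>rprod_shift_right\<close> splits off the opposite pair at \<open>k + 1\<close>. Both leave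
  \<open>rprod (b + 1) j k\<close>, so in the recurrences below the terms at \<open>k\<close> and
  \<open>k + 1\<close> share a common factor.\<close>

lemma rprod_shift_left:
  "rprod b (Suc j) k = rprod (b + 1) j k * ((k - of_nat j) * (k + b))"
proof (induction j)
  case (Suc j)
  show ?case
    unfolding rprod_Suc[of b "Suc j"] Suc.IH rprod_Suc[of "b + 1" j] by (simp add: mult_ac add_ac)
qed (simp add: rprod_Suc)

lemma rprod_shift_right:
  "rprod b (Suc j) (k + 1) = rprod (b + 1) j k * ((k + 1) * (k + 1 + b + of_nat j))"
proof (induction j)
  case (Suc j)
  show ?case
    unfolding rprod_Suc[of b "Suc j"] Suc.IH rprod_Suc[of "b + 1" j] by (simp add: mult_ac add_ac)
qed (simp add: rprod_Suc)

text \<open>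
  The lower parameters \<open>C, D\<close> of the balanced \<open>\<^sub>3F\<^sub>2\<close> enter only through \<open>d t = (t + C) (t + D)\<close> with
  \<open>C + D = A + b + 1\<close> and \<open>E = C D\<close>: in the application with \<open>Y = -X\<close> they are irrational.
  The right-hand side is the WZ certificate of the first-order recurrence in \<open>k\<close>.
\<close>

lemma saalschuetz_recurrence:
  fixes A b E k :: "'a::field_char_0"
  defines "d \<equiv> \<lambda>t. t ^ 2 + (A + b + 1) * t + E"
  defines "T \<equiv> \<lambda>k j. (- 1) ^ j * pochhammer A j * rprod b j k / (fact j * (\<Prod>i<j. d (of_nat i)))"
  assumes "\<And>i. i < n \<Longrightarrow> d (of_nat i) \<noteq> 0"
  shows "d k * (\<Sum>j\<le>n. T (k + 1) j) - d (k - A) * (\<Sum>j\<le>n. T k j) =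
    (- 1) ^ n * pochhammer A (Suc n) * (2 * k + 1 + b) * rprod (b + 1) n k /
    (fact n * (\<Prod>i<n. d (of_nat i)))"
  using assms(3)
proof (induction n)
  case 0
  show ?case by (simp add: T_def d_def power2_eq_square algebra_simps)
next
  case (Suc n)
  define P where "P = (- 1) ^ n * pochhammer A (Suc n) * rprod (b + 1) n k"
  define D where "D = fact n * (\<Prod>i<n. d (of_nat i))"
  have D: "D \<noteq> 0" "d (of_nat n) \<noteq> 0" "of_nat (Suc n) \<noteq> (0::'a)"
    using Suc.prems by (auto simp: D_def simp del: of_nat_Suc)
  have IH: "d k * (\<Sum>j\<le>n. T (k + 1) j) - d (k - A) * (\<Sum>j\<le>n. T k j) = P * (2 * k + 1 + b) / D"
    using Suc by (simp add: P_def D_def mult_ac)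
  have T1: "T (k + 1) (Suc n) = - P * ((k + 1) * (k + 1 + b + of_nat n)) / (of_nat (Suc n) * d (of_nat n) * D)"
    by (simp add: T_def P_def D_def rprod_shift_right mult_ac del: of_nat_Suc)
  have T0: "T k (Suc n) = - P * ((k - of_nat n) * (k + b)) / (of_nat (Suc n) * d (of_nat n) * D)"
    by (simp add: T_def P_def D_def rprod_shift_left mult_ac del: of_nat_Suc)
  have goal: "(- 1) ^ Suc n * pochhammer A (Suc (Suc n)) * (2 * k + 1 + b) * rprod (b + 1) (Suc n) k /
      (fact (Suc n) * (\<Prod>i<Suc n. d (of_nat i))) =
      P * (- ((A + of_nat (Suc n)) * (2 * k + 1 + b) * ((k - of_nat n) * (k + b + 1 + of_nat n))))
       / (of_nat (Suc n) * d (of_nat n) * D)"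
    unfolding pochhammer_Suc[of A "Suc n"]
    by (simp add: P_def D_def rprod_Suc mult_ac add_ac del: of_nat_Suc)
  \<comment> \<open>Once the common factor \<open>P\<close> and the denominators are removed, the
    induction step is this polynomial identity. The terms with \<open>E\<close> cancel; the linear
    coefficient \<open>A + b + 1\<close> of \<open>d\<close> is what makes the rest factor.\<close>
  have key: "of_nat (Suc n) * d (of_nat n) * (2 * k + 1 + b)
      - d k * ((k + 1) * (k + 1 + b + of_nat n)) + d (k - A) * ((k - of_nat n) * (k + b))
    = - ((A + of_nat (Suc n)) * (2 * k + 1 + b) * ((k - of_nat n) * (k + b + 1 + of_nat n)))"
    by (simp add: d_def power2_eq_square) algebra
  have "d k * (\<Sum>j\<le>Suc n. T (k + 1) j) - d (k - A) * (\<Sum>j\<le>Suc n. T k j)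
    = P * (2 * k + 1 + b) / D + d k * T (k + 1) (Suc n) - d (k - A) * T k (Suc n)"
    using IH by (simp add: algebra_simps)
  also have "\<dots> = P * (of_nat (Suc n) * d (of_nat n) * (2 * k + 1 + b)
      - d k * ((k + 1) * (k + 1 + b + of_nat n)) + d (k - A) * ((k - of_nat n) * (k + b)))
       / (of_nat (Suc n) * d (of_nat n) * D)"
    unfolding T1 T0 using D by (simp add: divide_simps del: of_nat_Suc) (simp add: algebra_simps del: of_nat_Suc)
  finally show ?case
    unfolding goal key .
qed

text \<open>Cut off at \<open>Suc k\<close>, the certificate contains
  \<open>rprod (b + 1) (Suc k) (of_nat k) = 0\<close>. The recurrence becomes homogeneous, and each
  step from \<open>k\<close> to \<open>k + 1\<close> multiplies the sum by
  \<open>d (k - A) / d k\<close>.\<close>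

lemma saalschuetz:
  fixes A b E :: "'a::field_char_0"
  defines "d \<equiv> \<lambda>t. t ^ 2 + (A + b + 1) * t + E"
  assumes "\<And>i. i < k \<Longrightarrow> d (of_nat i) \<noteq> 0"
  shows "(\<Sum>j\<le>k. (- 1) ^ j * pochhammer A j * rprod b j (of_nat k) / (fact j * (\<Prod>i<j. d (of_nat i))))
    = (\<Prod>i<k. d (of_nat i - A) / d (of_nat i))"
  using assms(2)
proof (induction k)
  case (Suc k)
  define T where "T = (\<lambda>k j. (- 1) ^ j * pochhammer A j * rprod b j k / (fact j * (\<Prod>i<j. d (of_nat i))))"
  have "d (of_nat k) * (\<Sum>j\<le>Suc k. T (of_nat k + 1) j) - d (of_nat k - A) * (\<Sum>j\<le>Suc k. T (of_nat k) j) = 0"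
    using saalschuetz_recurrence[of "Suc k" A b E "of_nat k"] Suc.prems
    by (simp add: T_def d_def rprod_eq_0)
  moreover have "(\<Sum>j\<le>Suc k. T (of_nat k) j) = (\<Prod>i<k. d (of_nat i - A) / d (of_nat i))"
    using Suc by (simp add: T_def rprod_eq_0)
  ultimately show ?case
    using Suc.prems[of k] by (simp add: T_def field_simps add_ac)
qed simp

text \<open>With \<open>X = x^2\<close> this is
  \<open>(a - x)_k (a + x)_k / ((1 - x)_k (1 + x)_k)\<close>, two parameter pairs of a well-poised
  series. Only \<open>x^2\<close> occurs, so \<open>X\<close> may be a nonsquare.\<close>

definition wp_prod :: "'a::field_char_0 \<Rightarrow> 'a \<Rightarrow> nat \<Rightarrow> 'a" where
  "wp_prod a X k = (\<Prod>i<k. ((a + of_nat i)\<^sup>2 - X) / ((of_nat i + 1)\<^sup>2 - X))"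

text \<open>Saalschuetz's summation read from right to left, with \<open>A = 1 - a\<close>,
  \<open>b = a\<close>, \<open>E = 1 - Y\<close>, for which \<open>d t = (t + 1)^2 - Y\<close>. It
  expands the product in the basis \<open>rprod a j\<close>, whose moments against
  \<open>wp_prod a X\<close> have closed forms.\<close>

lemma wp_prod_expansion:
  fixes a Y :: "'a::field_char_0"
  assumes "\<And>i. i < k \<Longrightarrow> (of_nat i + 1)\<^sup>2 \<noteq> Y"
  shows "wp_prod a Y k = (\<Sum>j\<le>k. (- 1) ^ j * pochhammer (1 - a) j * rprod a j (of_nat k) /
    (fact j * (\<Prod>i<j. (of_nat i + 1)\<^sup>2 - Y)))"
proof -
  have 1: "t ^ 2 + ((1 - a) + a + 1) * t + (1 - Y) = (t + 1)\<^sup>2 - Y" for t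
    by (simp add: power2_eq_square algebra_simps)
  have 2: "of_nat i - (1 - a) + 1 = a + of_nat i" for i by simp
  show ?thesis
    using saalschuetz[of k "1 - a" a "1 - Y"] assms
    unfolding 1 2 wp_prod_def by simp
qed

text \<open>The right-hand side is an antidifference of the summand, and it vanishes at
  \<open>n = 0\<close>. When it also vanishes at the upper end, a two-term recurrence in
  \<open>j\<close> for the moments remains.\<close>

lemma wp_moment_recurrence:
  fixes a X :: "'a::field_char_0"
  assumes "\<And>i. i < n \<Longrightarrow> (of_nat i + 1)\<^sup>2 \<noteq> X"
  shows "(\<Sum>k<n. (2 * of_nat k + a) * wp_prod a X k *
      ((a + of_nat j + 1) * rprod a (Suc j) (of_nat k) + (of_nat j + 1) * ((a + of_nat j)\<^sup>2 - X) * rprod a j (of_nat k)))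
    = ((of_nat n)\<^sup>2 - X) * wp_prod a X n * rprod (a - 1) (Suc j) (of_nat n)"
  using assms
proof (induction n)
  case 0
  show ?case by (simp add: rprod_eq_0[of 0, simplified])
next
  case (Suc n)
  define k :: 'a where "k = of_nat n"
  have s1: "rprod (a - 1) (Suc j) k = rprod a j k * ((k - of_nat j) * (k + a - 1))"
    using rprod_shift_left[of "a - 1" j k] by (simp add: algebra_simps)
  have s2: "rprod (a - 1) (Suc j) (k + 1) = rprod a j k * ((k + 1) * (k + a + of_nat j))"
    using rprod_shift_right[of "a - 1" j k] by (simp add: algebra_simps)
  have w: "((k + 1)\<^sup>2 - X) * wp_prod a X (Suc n) = ((a + k)\<^sup>2 - X) * wp_prod a X n"
    using Suc.prems[of n] by (simp add: wp_prod_def k_def)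
  have "?case \<longleftrightarrow> (k\<^sup>2 - X) * wp_prod a X n * rprod (a - 1) (Suc j) k +
      (2 * k + a) * wp_prod a X n *
      ((a + of_nat j + 1) * rprod a (Suc j) k + (of_nat j + 1) * ((a + of_nat j)\<^sup>2 - X) * rprod a j k)
      = (((k + 1)\<^sup>2 - X) * wp_prod a X (Suc n)) * rprod (a - 1) (Suc j) (k + 1)" (is "_ \<longleftrightarrow> ?E")
    using Suc by (simp add: k_def add_ac)
  moreover have ?E
    unfolding w s1 s2 rprod_Suc[of a j] by (simp add: power2_eq_square) algebra
  ultimately show ?case by (rule iffD2)
qed

text \<open>The sum telescopes because \<open>(a + k)^2 - k^2 = a * (2 * k + a)\<close>; the final
  \<open>X\<close> is the boundary value at \<open>n = 0\<close>.\<close>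

lemma wp_moment_0:
  fixes a X :: "'a::field_char_0"
  assumes "\<And>i. i < n \<Longrightarrow> (of_nat i + 1)\<^sup>2 \<noteq> X"
  shows "a * (\<Sum>k<n. (2 * of_nat k + a) * wp_prod a X k) = ((of_nat n)\<^sup>2 - X) * wp_prod a X n + X"
  using assms
proof (induction n)
  case 0
  show ?case by (simp add: wp_prod_def)
next
  case (Suc n)
  have w: "((of_nat n + 1)\<^sup>2 - X) * wp_prod a X (Suc n) = ((a + of_nat n)\<^sup>2 - X) * wp_prod a X n"
    using Suc.prems[of n] by (simp add: wp_prod_def)
  have "?case \<longleftrightarrow> ((of_nat n)\<^sup>2 - X) * wp_prod a X n + X + a * ((2 * of_nat n + a) * wp_prod a X n)
      = ((of_nat n + 1)\<^sup>2 - X) * wp_prod a X (Suc n) + X" (is "_ \<longleftrightarrow> ?E")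
    using Suc by (simp add: distrib_left add_ac)
  moreover have ?E
    unfolding w by (simp add: power2_eq_square algebra_simps)
  ultimately show ?case by (rule iffD2)
qed

text \<open>The choice of \<open>X\<close> kills the factor \<open>i = m\<close>, so
  \<open>wp_prod a X (Suc m) = 0\<close>. Then \<open>wp_moment_0\<close> gives the starting value
  \<open>X / a\<close>, and \<open>wp_moment_recurrence\<close> becomes a first-order recurrence in
  \<open>j\<close> without boundary term.\<close>

lemma wp_moment:
  fixes a X :: "'a::field_char_0"
  assumes X: "X = (a + of_nat m)\<^sup>2" and "\<And>i. i \<le> m \<Longrightarrow> (of_nat i + 1)\<^sup>2 \<noteq> X"
    and a: "\<And>i. a + of_nat i \<noteq> 0"
  shows "(\<Sum>k\<le>m. (2 * of_nat k + a) * wp_prod a X k * rprod a j (of_nat k))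
    = X / a * ((- 1) ^ j * fact j * (\<Prod>i<j. (a + of_nat i)\<^sup>2 - X) / pochhammer (1 + a) j)"
proof (induction j)
  have nz: "i < Suc m \<Longrightarrow> (of_nat i + 1)\<^sup>2 \<noteq> X" for i
    using assms(2)[of i] by simp
  have w0: "wp_prod a X (Suc m) = 0"
    by (simp add: wp_prod_def X)
  case 0
  show ?case
    using wp_moment_0[of "Suc m" X a, OF nz] a[of 0]
    by (simp add: w0 lessThan_Suc_atMost field_simps)
  case (Suc j)
  define S where "S = (\<lambda>j. \<Sum>k\<le>m. (2 * of_nat k + a) * wp_prod a X k * rprod a j (of_nat k))"
  define \<alpha> \<beta> where "\<alpha> = a + of_nat j + 1" and "\<beta> = (of_nat j + 1) * ((a + of_nat j)\<^sup>2 - X)"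
  have "(\<Sum>k<Suc m. (2 * of_nat k + a) * wp_prod a X k *
      (\<alpha> * rprod a (Suc j) (of_nat k) + \<beta> * rprod a j (of_nat k))) = 0"
    using wp_moment_recurrence[of "Suc m" X a j, OF nz] by (simp only: w0 \<alpha>_def \<beta>_def) simp
  then have "\<alpha> * S (Suc j) + \<beta> * S j = 0"
    by (simp only: S_def lessThan_Suc_atMost sum_distrib_left distrib_left sum.distrib mult.left_commute)
  then have "S (Suc j) = - ((of_nat j + 1) * ((a + of_nat j)\<^sup>2 - X) * S j / (1 + a + of_nat j))"
    using a[of "Suc j"] by (simp add: \<alpha>_def \<beta>_def field_simps add_eq_0_iff)
  moreover have "S j = X / a * ((- 1) ^ j * fact j * (\<Prod>i<j. (a + of_nat i)\<^sup>2 - X) / pochhammer (1 + a) j)"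
    using Suc by (simp add: S_def)
  ultimately have "S (Suc j) = X / a * ((- 1) ^ Suc j * fact (Suc j) * (\<Prod>i<Suc j. (a + of_nat i)\<^sup>2 - X) /
      pochhammer (1 + a) (Suc j))"
    by (simp add: S_def[symmetric] pochhammer_Suc mult_ac add_ac)
  then show ?case by (simp only: S_def)
qed

text \<open>Expand \<open>wp_prod a Y\<close> in the basis \<open>rprod a j\<close>, interchange the
  sums, and insert the moments. The result is a balanced \<open>4F3\<close> with 1 among its upper
  parameters.\<close>

lemma whipple_well_poised:
  fixes a X Y :: "'a::field_char_0"
  assumes X: "X = (a + of_nat m)\<^sup>2"
    and nzX: "\<And>i. i \<le> m \<Longrightarrow> (of_nat i + 1)\<^sup>2 \<noteq> X"
    and nzY: "\<And>i. i < m \<Longrightarrow> (of_nat i + 1)\<^sup>2 \<noteq> Y"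
    and a: "\<And>i. a + of_nat i \<noteq> 0"
  shows "(\<Sum>k\<le>m. (2 * of_nat k + a) * wp_prod a X k * wp_prod a Y k) =
    X / a * (\<Sum>j\<le>m. pochhammer (1 - a) j / pochhammer (1 + a) j *
      (\<Prod>i<j. ((a + of_nat i)\<^sup>2 - X) / ((of_nat i + 1)\<^sup>2 - Y)))"
proof -
  define c where "c = (\<lambda>j. (- 1) ^ j * pochhammer (1 - a) j / (fact j * (\<Prod>i<j. (of_nat i + 1)\<^sup>2 - Y)))"
  have exp: "wp_prod a Y k = (\<Sum>j\<le>m. c j * rprod a j (of_nat k))" if "k \<le> m" for k
  proof -
    have "wp_prod a Y k = (\<Sum>j\<le>k. c j * rprod a j (of_nat k))"
      using wp_prod_expansion[of k Y a] nzY that by (simp add: c_def)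
    \<comment> \<open>The added terms vanish; the range of \<open>j\<close> no longer depends on
      \<open>k\<close>, so the sums can be interchanged.\<close>
    also have "\<dots> = (\<Sum>j\<le>m. c j * rprod a j (of_nat k))"
      using that by (intro sum.mono_neutral_left) (auto simp: rprod_eq_0)
    finally show ?thesis .
  qed
  have "(\<Sum>k\<le>m. (2 * of_nat k + a) * wp_prod a X k * wp_prod a Y k) =
      (\<Sum>k\<le>m. \<Sum>j\<le>m. c j * ((2 * of_nat k + a) * wp_prod a X k * rprod a j (of_nat k)))"
    by (simp add: exp sum_distrib_left mult_ac)
  also have "\<dots> = (\<Sum>j\<le>m. c j * (\<Sum>k\<le>m. (2 * of_nat k + a) * wp_prod a X k * rprod a j (of_nat k)))"
    by (subst sum.swap) (simp add: sum_distrib_left)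
  also have "\<dots> = (\<Sum>j\<le>m. X / a * (pochhammer (1 - a) j / pochhammer (1 + a) j *
      (\<Prod>i<j. ((a + of_nat i)\<^sup>2 - X) / ((of_nat i + 1)\<^sup>2 - Y))))"
  proof (rule sum.cong)
    fix j
    have "(- 1) ^ j * (- 1) ^ j = (1::'a)"
      by (simp flip: power_mult_distrib)
    then show "c j * (\<Sum>k\<le>m. (2 * of_nat k + a) * wp_prod a X k * rprod a j (of_nat k)) =
      X / a * (pochhammer (1 - a) j / pochhammer (1 + a) j *
      (\<Prod>i<j. ((a + of_nat i)\<^sup>2 - X) / ((of_nat i + 1)\<^sup>2 - Y)))"
      unfolding wp_moment[OF X nzX a, simplified] by (simp add: c_def prod_dividef field_simps)
  qed simp
  finally show ?thesis by (simp add: sum_distrib_left)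
qed

text \<open>For \<open>a = 1 / 2\<close> this is the quotient \<open>(1 - a)_j / (1 + a)_j\<close>
  in Whipple's transformation, the source of the denominators
  \<open>2 * of_nat j + 1\<close>.\<close>

lemma pochhammer_quot_shift_half:
  "pochhammer (1 / 2) j / pochhammer (3 / 2) j = 1 / (2 * of_nat j + 1 :: 'a::field_char_0)"
proof (induction j)
  case (Suc j)
  have nz: "2 * of_nat j + 1 \<noteq> (0::'a)" "2 * of_nat j + 3 \<noteq> (0::'a)"
    using of_nat_neq_0[of "2 * j", where ?'a = 'a] of_nat_neq_0[of "2 * j + 2", where ?'a = 'a]
    by (simp_all add: add_ac)
  have "pochhammer (1 / 2) (Suc j) / pochhammer (3 / 2) (Suc j)
      = pochhammer (1 / 2) j / pochhammer (3 / 2) j * ((1 / 2 + of_nat j) / (3 / 2 + of_nat j :: 'a))"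
    by (simp add: pochhammer_Suc)
  also have "(1 / 2 + of_nat j) / (3 / 2 + of_nat j :: 'a) = (2 * of_nat j + 1) / (2 * of_nat j + 3)"
    using mult_divide_mult_cancel_left[of 2 "1 / 2 + of_nat j" "3 / 2 + of_nat j :: 'a"]
    by (simp add: distrib_left add.commute)
  also have "pochhammer (1 / 2) j / pochhammer (3 / 2) j = 1 / (2 * of_nat j + 1 :: 'a)"
    by (rule Suc)
  also have "1 / (2 * of_nat j + 1) * ((2 * of_nat j + 1) / (2 * of_nat j + 3)) = 1 / (2 * of_nat (Suc j) + 1 :: 'a)"
    using nz by (simp add: field_simps)
  finally show ?case .
qed simp

text \<open>The sum in Whipple's transformation at \<open>a = 1 / 2\<close> and
  \<open>Y = 0\<close>. Writing \<open>1 / (2j + 1)\<close> as \<open>(1/2)_j / (3/2)_j\<close>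
  turns it into Saalschuetz's sum with \<open>A = 1 / 2\<close>, \<open>b = 1\<close>,
  \<open>E = 3 / 2\<close>. Then \<open>d t = (t + 1) * (3 / 2 + t)\<close>, and after cancellation
  the product telescopes.\<close>

lemma saalschuetz_half:
  fixes X :: "'a::field_char_0"
  assumes X: "X = (1 / 2 + of_nat m)\<^sup>2"
  shows "(\<Sum>j\<le>m. (\<Prod>i<j. ((1 / 2 + of_nat i)\<^sup>2 - X) / (of_nat i + 1)\<^sup>2) / (2 * of_nat j + 1))
    = 1 / (2 * of_nat m + 1)"
proof -
  have d: "t ^ 2 + (1 / 2 + 1 + 1) * t + 3 / 2 = (t + 1) * (3 / 2 + t)" for t :: 'a
    by (simp add: power2_eq_square field_simps)
  have nz: "1 + of_nat i \<noteq> (0::'a)" "3 / 2 + of_nat i \<noteq> (0::'a)" for i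
    using of_nat_neq_0[of i, where ?'a = 'a] of_nat_neq_0[of "2 * i + 2", where ?'a = 'a]
    by (auto simp: field_simps)
  have "(\<Sum>j\<le>m. (\<Prod>i<j. ((1 / 2 + of_nat i)\<^sup>2 - X) / (of_nat i + 1)\<^sup>2) / (2 * of_nat j + 1)) =
      (\<Sum>j\<le>m. (- 1) ^ j * pochhammer (1 / 2) j * rprod 1 j (of_nat m) /
        (fact j * (\<Prod>i<j. (of_nat i + 1) * (3 / 2 + of_nat i))))"
  proof (rule sum.cong)
    fix j
    have "(1 / 2 + of_nat i)\<^sup>2 - X = - ((of_nat m - of_nat i) * (of_nat m + 1 + of_nat i))" for i
      by (simp add: X power2_eq_square field_simps)
    then have "(\<Prod>i<j. (1 / 2 + of_nat i)\<^sup>2 - X) = (- 1) ^ j * rprod 1 j (of_nat m)"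
      unfolding rprod_def by (induction j) simp_all
    moreover have f: "(\<Prod>i<j. of_nat i + 1) = (fact j :: 'a)" "(\<Prod>i<j. 3 / 2 + of_nat i) = pochhammer (3 / 2 :: 'a) j"
      by (simp_all add: fact_prod_Suc pochhammer_prod atLeast0LessThan add.commute)
    ultimately have "(\<Prod>i<j. ((1 / 2 + of_nat i)\<^sup>2 - X) / (of_nat i + 1)\<^sup>2) = (- 1) ^ j * rprod 1 j (of_nat m) / (fact j)\<^sup>2"
      by (simp add: prod_dividef flip: prod_power_distrib)
    then have "(\<Prod>i<j. ((1 / 2 + of_nat i)\<^sup>2 - X) / (of_nat i + 1)\<^sup>2) / (2 * of_nat j + 1) =
        (- 1) ^ j * rprod 1 j (of_nat m) / (fact j)\<^sup>2 * (pochhammer (1 / 2) j / pochhammer (3 / 2) j)"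
      unfolding pochhammer_quot_shift_half by simp
    also have "\<dots> = (- 1) ^ j * pochhammer (1 / 2) j * rprod 1 j (of_nat m) /
        (fact j * (\<Prod>i<j. (of_nat i + 1) * (3 / 2 + of_nat i)))"
      unfolding prod.distrib f by (simp add: power2_eq_square mult_ac)
    finally show "(\<Prod>i<j. ((1 / 2 + of_nat i)\<^sup>2 - X) / (of_nat i + 1)\<^sup>2) / (2 * of_nat j + 1) =
        (- 1) ^ j * pochhammer (1 / 2) j * rprod 1 j (of_nat m) /
        (fact j * (\<Prod>i<j. (of_nat i + 1) * (3 / 2 + of_nat i)))" .
  qed simp
  also have "\<dots> = (\<Prod>i<m. (of_nat i - 1 / 2 + 1) * (3 / 2 + (of_nat i - 1 / 2)) / ((of_nat i + 1) * (3 / 2 + of_nat i)))"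
    using saalschuetz[of m "1 / 2" 1 "3 / 2 :: 'a"] nz unfolding d by (simp add: add.commute)
  also have "\<dots> = (\<Prod>i<m. (1 / 2 + of_nat i) / (3 / 2 + of_nat i))"
  proof (rule prod.cong)
    fix i
    have "of_nat i - 1 / 2 + 1 = 1 / 2 + (of_nat i :: 'a)" "3 / 2 + (of_nat i - 1 / 2) = 1 + (of_nat i :: 'a)"
      by simp_all
    then show "(of_nat i - 1 / 2 + 1) * (3 / 2 + (of_nat i - 1 / 2)) / ((of_nat i + 1) * (3 / 2 + of_nat i)) =
        (1 / 2 + of_nat i) / (3 / 2 + of_nat i :: 'a)"
      using nz[of i] by (simp only: add.commute[of "of_nat i" 1]) simp
  qed simp
  also have "\<dots> = 1 / (2 * of_nat m + 1)"
    using pochhammer_quot_shift_half[of m, where ?'a = 'a]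
    by (simp add: prod_dividef pochhammer_prod atLeast0LessThan)
  finally show ?thesis .
qed

section \<open>Rationals integral at a prime\<close>

text \<open>The reduced denominator divides every other one, so any fraction with denominator
  coprime to \<open>p\<close> is a witness. Closure under sums and products then needs no reduction
  to lowest terms.\<close>

lemma rat_coprime_denom_iff:
  "x \<in> rat_coprime_denom p \<longleftrightarrow> (\<exists>a b. b \<noteq> 0 \<and> coprime b (int p) \<and> x = of_int a / of_int b)"
proof
  assume x: "x \<in> rat_coprime_denom p"
  obtain a b where ab: "quotient_of x = (a, b)" by fastforce
  have "b \<noteq> 0" "x = of_int a / of_int b"
    using quotient_of_denom_pos[OF ab] quotient_of_div[OF ab] by auto
  moreover have "coprime b (int p)"
    using x ab by (simp add: rat_coprime_denom_def)
  ultimately show "\<exists>a b. b \<noteq> 0 \<and> coprime b (int p) \<and> x = of_int a / of_int b"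
    by blast
next
  assume "\<exists>a b. b \<noteq> 0 \<and> coprime b (int p) \<and> x = of_int a / of_int b"
  then obtain a b where ab: "b \<noteq> 0" "coprime b (int p)" "x = of_int a / of_int b"
    by blast
  obtain c d where cd: "quotient_of x = (c, d)" by fastforce
  have d: "d > 0" "coprime c d"
    using quotient_of_denom_pos[OF cd] quotient_of_coprime[OF cd] by auto
  have "of_int a / of_int b = (of_int c / of_int d :: rat)"
    using ab(3) quotient_of_div[OF cd] by simp
  then have "of_int (a * d) = (of_int (c * b) :: rat)"
    using ab(1) d(1) by (simp add: frac_eq_eq)
  then have "a * d = c * b"
    by (simp only: of_int_eq_iff)
  then have "d dvd c * b"
    by (metis dvd_triv_right)
  then have "d dvd b"
    using d(2) by (simp add: coprime_commute coprime_dvd_mult_right_iff)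
  then show "x \<in> rat_coprime_denom p"
    using coprime_divisors[OF _ dvd_refl ab(2)] cd by (simp add: rat_coprime_denom_def)
qed

lemma rat_coprime_denomI:
  "b \<noteq> 0 \<Longrightarrow> coprime b (int p) \<Longrightarrow> x = of_int a / of_int b \<Longrightarrow> x \<in> rat_coprime_denom p"
  by (auto simp only: rat_coprime_denom_iff)

lemma rat_coprime_denomE:
  assumes "x \<in> rat_coprime_denom p"
  obtains a b where "b \<noteq> 0" "coprime b (int p)" "x = of_int a / of_int b"
  using assms unfolding rat_coprime_denom_iff by blast

text \<open>The ideal generated by \<open>p ^ n\<close>: congruences become memberships of
  differences and can be derived by closure rules.\<close>

definition p_multiples :: "nat \<Rightarrow> nat \<Rightarrow> rat set" where
  "p_multiples p n = (\<lambda>z. of_nat p ^ n * z) ` rat_coprime_denom p"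

lemma p_multiplesI:
  "z \<in> rat_coprime_denom p \<Longrightarrow> x = of_nat p ^ n * z \<Longrightarrow> x \<in> p_multiples p n"
  by (auto simp: p_multiples_def)

lemma p_multiplesE:
  assumes "x \<in> p_multiples p n"
  obtains z where "z \<in> rat_coprime_denom p" "x = of_nat p ^ n * z"
  using assms by (auto simp: p_multiples_def)

lemma p_multiples_0 [simp]: "p_multiples p 0 = rat_coprime_denom p"
  by (simp add: p_multiples_def)

lemma rat_cong_iff:
  "rat_cong p x y (p ^ n) \<longleftrightarrow>
    x \<in> rat_coprime_denom p \<and> y \<in> rat_coprime_denom p \<and> x - y \<in> p_multiples p n"
  by (auto simp: rat_cong_def p_multiples_def)

section \<open>Closure properties of the ring and its ideals\<close>

lemma of_int_in_rat_coprime_denom [simp]: "of_int a \<in> rat_coprime_denom p"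
  unfolding rat_coprime_denom_iff by (rule exI[of _ a], rule exI[of _ 1]) simp

lemma of_nat_in_rat_coprime_denom [simp]: "of_nat a \<in> rat_coprime_denom p"
  using of_int_in_rat_coprime_denom[of "int a"] by simp

lemma numeral_in_rat_coprime_denom [simp]: "numeral a \<in> rat_coprime_denom p"
  using of_nat_in_rat_coprime_denom[of "numeral a"] by simp

lemma one_in_rat_coprime_denom [simp]: "1 \<in> rat_coprime_denom p"
  using of_nat_in_rat_coprime_denom[of 1] by simp

lemma zero_in_rat_coprime_denom [simp]: "0 \<in> rat_coprime_denom p"
  using of_nat_in_rat_coprime_denom[of 0] by simp

lemma add_in_rat_coprime_denom:
  assumes "x \<in> rat_coprime_denom p" "y \<in> rat_coprime_denom p"
  shows "x + y \<in> rat_coprime_denom p"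
proof -
  from assms(1) obtain a b where ab: "b \<noteq> 0" "coprime b (int p)" "x = of_int a / of_int b"
    by (rule rat_coprime_denomE)
  from assms(2) obtain c d where cd: "d \<noteq> 0" "coprime d (int p)" "y = of_int c / of_int d"
    by (rule rat_coprime_denomE)
  from ab cd have "b * d \<noteq> 0" "coprime (b * d) (int p)" "x + y = of_int (a * d + c * b) / of_int (b * d)"
    by (simp_all add: add_frac_eq)
  then show ?thesis by (rule rat_coprime_denomI)
qed

lemma mult_in_rat_coprime_denom:
  assumes "x \<in> rat_coprime_denom p" "y \<in> rat_coprime_denom p"
  shows "x * y \<in> rat_coprime_denom p"
proof -
  from assms(1) obtain a b where ab: "b \<noteq> 0" "coprime b (int p)" "x = of_int a / of_int b"
    by (rule rat_coprime_denomE)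
  from assms(2) obtain c d where cd: "d \<noteq> 0" "coprime d (int p)" "y = of_int c / of_int d"
    by (rule rat_coprime_denomE)
  from ab cd have "b * d \<noteq> 0" "coprime (b * d) (int p)" "x * y = of_int (a * c) / of_int (b * d)"
    by simp_all
  then show ?thesis by (rule rat_coprime_denomI)
qed

lemma uminus_in_rat_coprime_denom:
  "x \<in> rat_coprime_denom p \<Longrightarrow> - x \<in> rat_coprime_denom p"
  using mult_in_rat_coprime_denom[of "of_int (- 1)" p x, OF of_int_in_rat_coprime_denom] by simp

lemma diff_in_rat_coprime_denom:
  "x \<in> rat_coprime_denom p \<Longrightarrow> y \<in> rat_coprime_denom p \<Longrightarrow> x - y \<in> rat_coprime_denom p"
  using add_in_rat_coprime_denom[of x p "- y", OF _ uminus_in_rat_coprime_denom] by simp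

lemma power_in_rat_coprime_denom:
  "x \<in> rat_coprime_denom p \<Longrightarrow> x ^ n \<in> rat_coprime_denom p"
  by (induction n) (simp_all add: mult_in_rat_coprime_denom)

lemma prod_in_rat_coprime_denom:
  "(\<And>i. i \<in> A \<Longrightarrow> f i \<in> rat_coprime_denom p) \<Longrightarrow> prod f A \<in> rat_coprime_denom p"
  by (induction A rule: infinite_finite_induct) (simp_all add: mult_in_rat_coprime_denom)

lemma p_multiples_subset: "p_multiples p n \<subseteq> rat_coprime_denom p"
  by (auto simp: p_multiples_def intro!: mult_in_rat_coprime_denom power_in_rat_coprime_denom)

lemma p_multiples_mono: "m \<le> n \<Longrightarrow> p_multiples p n \<subseteq> p_multiples p m"
proof
  fix x assume "m \<le> n" "x \<in> p_multiples p n"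
  then obtain z where "z \<in> rat_coprime_denom p" "x = of_nat p ^ n * z"
    by (auto simp: p_multiples_def)
  then have "x = of_nat p ^ m * (of_nat p ^ (n - m) * z)" "of_nat p ^ (n - m) * z \<in> rat_coprime_denom p"
    using \<open>m \<le> n\<close> power_add[of "of_nat p :: rat" m "n - m"]
    by (simp_all add: mult_in_rat_coprime_denom power_in_rat_coprime_denom)
  then show "x \<in> p_multiples p m"
    by (intro p_multiplesI)
qed

lemma add_in_p_multiples:
  "x \<in> p_multiples p n \<Longrightarrow> y \<in> p_multiples p n \<Longrightarrow> x + y \<in> p_multiples p n"
proof (elim p_multiplesE)
  fix u v assume "u \<in> rat_coprime_denom p" "v \<in> rat_coprime_denom p" "x = of_nat p ^ n * u" "y = of_nat p ^ n * v"
  then show ?thesis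
    by (intro p_multiplesI[of "u + v"] add_in_rat_coprime_denom) (simp_all add: distrib_left)
qed

lemma diff_in_p_multiples:
  "x \<in> p_multiples p n \<Longrightarrow> y \<in> p_multiples p n \<Longrightarrow> x - y \<in> p_multiples p n"
proof (elim p_multiplesE)
  fix u v assume "u \<in> rat_coprime_denom p" "v \<in> rat_coprime_denom p" "x = of_nat p ^ n * u" "y = of_nat p ^ n * v"
  then show ?thesis
    by (intro p_multiplesI[of "u - v"] diff_in_rat_coprime_denom) (simp_all add: right_diff_distrib)
qed

lemma zero_in_p_multiples [simp]: "0 \<in> p_multiples p n"
  unfolding p_multiples_def by (rule image_eqI[of _ _ 0]) simp_all

lemma mult_in_p_multiples:
  assumes "x \<in> p_multiples p m" "y \<in> p_multiples p n"
  shows "x * y \<in> p_multiples p (m + n)"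
proof -
  from assms(1) obtain u where u: "u \<in> rat_coprime_denom p" "x = of_nat p ^ m * u"
    by (rule p_multiplesE)
  from assms(2) obtain v where v: "v \<in> rat_coprime_denom p" "y = of_nat p ^ n * v"
    by (rule p_multiplesE)
  from u v have "x * y = of_nat p ^ (m + n) * (u * v)" "u * v \<in> rat_coprime_denom p"
    by (simp_all add: power_add mult_in_rat_coprime_denom)
  then show ?thesis by (intro p_multiplesI)
qed

lemma mult_left_in_p_multiples:
  "x \<in> rat_coprime_denom p \<Longrightarrow> y \<in> p_multiples p n \<Longrightarrow> x * y \<in> p_multiples p n"
  using mult_in_p_multiples[of x p 0 y n] by simp

lemma mult_right_in_p_multiples:
  "x \<in> p_multiples p n \<Longrightarrow> y \<in> rat_coprime_denom p \<Longrightarrow> x * y \<in> p_multiples p n"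
  using mult_in_p_multiples[of x p n y 0] by simp

lemma sum_in_p_multiples:
  "(\<And>i. i \<in> A \<Longrightarrow> f i \<in> p_multiples p n) \<Longrightarrow> sum f A \<in> p_multiples p n"
  by (induction A rule: infinite_finite_induct) (auto intro: add_in_p_multiples)

lemma power_p_in_p_multiples: "of_nat p ^ n \<in> p_multiples p n"
  unfolding p_multiples_def by (rule image_eqI[of _ _ 1]) simp_all

section \<open>Congruences between products\<close>

lemma prod_cong_p_multiples:
  assumes "\<And>i. i \<in> A \<Longrightarrow> f i \<in> rat_coprime_denom p" "\<And>i. i \<in> A \<Longrightarrow> g i \<in> rat_coprime_denom p"
    "\<And>i. i \<in> A \<Longrightarrow> f i - g i \<in> p_multiples p n"
  shows "prod f A - prod g A \<in> p_multiples p n"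
  using assms
proof (induction A rule: infinite_finite_induct)
  case (insert i A)
  have "prod f (insert i A) - prod g (insert i A)
      = f i * (prod f A - prod g A) + (f i - g i) * prod g A"
    using insert.hyps by (simp add: algebra_simps)
  then show ?case
    using insert by (simp add: prod_in_rat_coprime_denom add_in_p_multiples mult_left_in_p_multiples mult_right_in_p_multiples)
qed auto

text \<open>First-order expansion: every further term contains \<open>X * X\<close>, which lies in
  the ideal of \<open>p ^ (n + n)\<close>.\<close>

lemma prod_one_plus_cong:
  assumes "X \<in> p_multiples p n" "\<And>i. i \<in> A \<Longrightarrow> c i \<in> rat_coprime_denom p"
  shows "(\<Prod>i\<in>A. 1 + X * c i) - 1 - X * sum c A \<in> p_multiples p (n + n)"
  using assms(2)
proof (induction A rule: infinite_finite_induct)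
  case (insert i A)
  have X: "X \<in> rat_coprime_denom p"
    using assms(1) p_multiples_subset by blast
  have c: "sum c A \<in> rat_coprime_denom p"
    using sum_in_p_multiples[of A c p 0] insert.prems by simp
  have "(\<Prod>i\<in>insert i A. 1 + X * c i) - 1 - X * sum c (insert i A)
      = (1 + X * c i) * ((\<Prod>i\<in>A. 1 + X * c i) - 1 - X * sum c A) + X * X * (c i * sum c A)"
    using insert.hyps by (simp add: algebra_simps)
  then show ?case
    using insert X c assms(1)
    by (simp add: add_in_p_multiples mult_left_in_p_multiples
        mult_in_rat_coprime_denom add_in_rat_coprime_denom mult_right_in_p_multiples mult_in_p_multiples)
qed auto

section \<open>Units and quotients at a prime\<close>

context
  fixes p :: nat
  assumes p: "prime p"
begin

lemma of_nat_in_p_multiples_iff: "of_nat n \<in> p_multiples p 1 \<longleftrightarrow> p dvd n"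
proof
  assume "of_nat n \<in> p_multiples p 1"
  then obtain z where z: "(of_nat n :: rat) = of_nat p * z" "z \<in> rat_coprime_denom p"
    by (auto simp: p_multiples_def)
  then obtain a b where "b \<noteq> 0" "coprime b (int p)" "z = of_int a / of_int b"
    by (blast elim: rat_coprime_denomE)
  with z have ab: "b \<noteq> 0" "coprime b (int p)" "(of_nat n :: rat) = of_nat p * (of_int a / of_int b)"
    by simp_all
  then have "of_int (int n * b) = (of_int (int p * a) :: rat)"
    by (simp add: field_simps)
  then have "int n * b = int p * a"
    by (simp only: of_int_eq_iff)
  then have "int p dvd int n * b"
    by simp
  then show "p dvd n"
    using ab(2) by (simp add: coprime_commute coprime_dvd_mult_left_iff)
next
  assume "p dvd n"
  then obtain k where "n = p * k" ..
  then show "of_nat n \<in> p_multiples p 1"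
    by (intro p_multiplesI[of "of_nat k"]) simp_all
qed

text \<open>The ring is local: outside the ideal of \<open>p\<close> every element is a unit. Hence
  \<open>\<notin> p_multiples p 1\<close> is the form in which denominators are controlled from here
  on.\<close>

lemma inverse_in_rat_coprime_denom:
  assumes "x \<in> rat_coprime_denom p" "x \<notin> p_multiples p 1"
  shows "inverse x \<in> rat_coprime_denom p"
proof -
  obtain a b where ab: "b \<noteq> 0" "coprime b (int p)" "x = of_int a / of_int b"
    using assms(1) by (rule rat_coprime_denomE)
  have "\<not> int p dvd a"
  proof
    assume "int p dvd a"
    then obtain c where "a = int p * c" by blast
    then have "x = of_nat p ^ 1 * (of_int c / of_int b)"
      using ab by simp
    moreover have "of_int c / of_int b \<in> rat_coprime_denom p"
      by (rule rat_coprime_denomI[OF ab(1,2) refl])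
    ultimately show False
      using assms(2) unfolding p_multiples_def by blast
  qed
  then have "a \<noteq> 0" "coprime a (int p)"
    using p prime_imp_coprime[of "int p" a] by (auto simp: coprime_commute)
  then show ?thesis
    unfolding ab(3) by (intro rat_coprime_denomI[of a p _ b]) simp_all
qed

lemma divide_in_rat_coprime_denom:
  "x \<in> rat_coprime_denom p \<Longrightarrow> y \<in> rat_coprime_denom p \<Longrightarrow> y \<notin> p_multiples p 1 \<Longrightarrow>
    x / y \<in> rat_coprime_denom p"
  unfolding divide_inverse by (intro mult_in_rat_coprime_denom inverse_in_rat_coprime_denom)

lemma divide_in_p_multiples:
  "x \<in> p_multiples p n \<Longrightarrow> y \<in> rat_coprime_denom p \<Longrightarrow> y \<notin> p_multiples p 1 \<Longrightarrow>
    x / y \<in> p_multiples p n"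
  unfolding divide_inverse by (intro mult_right_in_p_multiples inverse_in_rat_coprime_denom)

lemma divide_cong_p_multiples:
  assumes "b \<in> rat_coprime_denom p" "b \<notin> p_multiples p 1" "d \<in> rat_coprime_denom p" "d \<notin> p_multiples p 1"
    "a \<in> rat_coprime_denom p"
    "a - c \<in> p_multiples p n" "b - d \<in> p_multiples p n"
  shows "a / b - c / d \<in> p_multiples p n"
proof -
  have "b \<noteq> 0" "d \<noteq> 0"
    using assms by auto
  \<comment> \<open>Both quotients are compared with \<open>a / d\<close>.\<close>
  then have "a / b - c / d = (a - c) / d - a * ((b - d) / d / b)"
    by (simp add: field_simps)
  also have "\<dots> \<in> p_multiples p n"
    by (rule diff_in_p_multiples[OF divide_in_p_multiples[OF assms(6,3,4)]
      mult_left_in_p_multiples[OF assms(5) divide_in_p_multiples[OF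
        divide_in_p_multiples[OF assms(7,3,4)] assms(1,2)]]])
  finally show ?thesis .
qed

end

lemmas rat_coprime_denom_closed =
  add_in_rat_coprime_denom diff_in_rat_coprime_denom mult_in_rat_coprime_denom
  uminus_in_rat_coprime_denom power_in_rat_coprime_denom

section \<open>The supercongruence modulo the fourth power\<close>

lemma sum_lessThan_double_reflect:
  fixes f :: "nat \<Rightarrow> 'a::comm_monoid_add"
  shows "(\<Sum>i<2 * m. f (i + 1)) = (\<Sum>i<m. f (i + 1)) + (\<Sum>i<m. f (2 * m + 1 - (i + 1)))"
proof -
  have split: "(\<Sum>i<m + n. f (i + 1)) = (\<Sum>i<m. f (i + 1)) + (\<Sum>i<n. f (m + i + 1))" for n
    by (induction n) (simp_all add: add_ac)
  have "(\<Sum>i<m. f (m + i + 1)) = (\<Sum>i<m. f (2 * m + 1 - (i + 1)))"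
    by (subst sum.nat_diff_reindex[symmetric]) (rule sum.cong, auto)
  then show ?thesis
    using split[of m] by (simp add: mult_2)
qed

text \<open>The odd numbers below \<open>2 * m + 1\<close> are the reflections of the even ones.
  With \<open>p = 2 * m + 1\<close>, this and the splitting into lower and upper half compare one
  sum over the nonzero residues with two different sums over \<open>m\<close> terms.\<close>

lemma sum_lessThan_double_parity:
  fixes f :: "nat \<Rightarrow> 'a::comm_monoid_add"
  shows "(\<Sum>i<2 * m. f (i + 1)) = (\<Sum>i<m. f (2 * (i + 1))) + (\<Sum>i<m. f (2 * m + 1 - 2 * (i + 1)))"
proof -
  have "(\<Sum>i<2 * m. f (i + 1)) = (\<Sum>i<m. f (2 * (i + 1))) + (\<Sum>i<m. f (2 * i + 1))"
    by (induction m) (simp_all add: add_ac)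
  also have "(\<Sum>i<m. f (2 * i + 1)) = (\<Sum>i<m. f (2 * m + 1 - 2 * (i + 1)))"
    by (subst sum.nat_diff_reindex[symmetric]) (rule sum.cong, auto intro!: arg_cong[of _ _ f])
  finally show ?thesis .
qed

section \<open>Telescoping sums with the hypergeometric weight\<close>

definition weight :: "nat \<Rightarrow> rat" where
  "weight k = pochhammer (- 1 / 2) k ^ 4 / fact k ^ 4"

text \<open>Since \<open>weight (Suc k) = ((4k - 2) / (4k + 4))^4 * weight k\<close>, the summand is
  \<open>G (k + 1) - G k\<close> for \<open>G k = (4k)^4 * q (4k - 3) * weight k\<close>, and
  \<open>G 0 = 0\<close>.\<close>

lemma telescope_weight:
  fixes q :: "rat \<Rightarrow> rat"
  shows "(\<Sum>k\<le>n. ((4 * of_nat k - 2) ^ 4 * q (4 * of_nat k + 1) - (4 * of_nat k) ^ 4 * q (4 * of_nat k - 3)) * weight k)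
    = (4 * of_nat n - 2) ^ 4 * q (4 * of_nat n + 1) * weight n"
proof (induction n)
  case (Suc n)
  have nz: "1 + of_nat n \<noteq> (0::rat)"
    using of_nat_neq_0[of n, where ?'a = rat] by simp
  have "weight (Suc n) = ((4 * of_nat n - 2) / (4 + 4 * of_nat n)) ^ 4 * weight n"
  proof -
    have "(- 1 / 2 + of_nat n) / (1 + of_nat n) = (4 * of_nat n - 2) / (4 + 4 * of_nat n :: rat)"
      using mult_divide_mult_cancel_left[of 4 "- 1 / 2 + of_nat n" "1 + of_nat n :: rat"]
      by (simp add: distrib_left)
    moreover have "weight (Suc n) = ((- 1 / 2 + of_nat n) / (1 + of_nat n)) ^ 4 * weight n"
      by (simp add: weight_def pochhammer_Suc power_mult_distrib power_divide mult_ac)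
    ultimately show ?thesis
      by simp
  qed
  moreover have "4 + 4 * of_nat n \<noteq> (0::rat)"
    using of_nat_neq_0[of "4 * n + 3", where ?'a = rat] by (simp add: add_ac)
  ultimately have "(4 * of_nat (Suc n)) ^ 4 * weight (Suc n) = (4 * of_nat n - 2) ^ 4 * weight n"
    by (simp add: power_divide)
  then have weight: "(4 * of_nat (Suc n)) ^ 4 * Q * weight (Suc n) = (4 * of_nat n - 2) ^ 4 * Q * weight n" for Q
    by (simp only: mult.commute[of _ Q] mult.assoc)
  have arg: "4 * of_nat (Suc n) - 3 = 4 * of_nat n + (1 :: rat)"
    by simp
  show ?case
    unfolding sum.atMost_Suc Suc.IH unfolding left_diff_distrib arg weight by simp
qed (simp add: weight_def)

section \<open>Inverse squares modulo \<open>p\<close> and the congruence for the sum with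
  \<open>(4k + 1) (1/2)_k^4 / k!^4\<close>\<close>

context
  fixes p :: nat
  assumes p: "prime p"
begin

lemma of_nat_diff_notin_p_multiples:
  assumes "\<not> p dvd n" "Y \<in> p_multiples p 1"
  shows "of_nat n - Y \<notin> p_multiples p 1"
proof
  assume "of_nat n - Y \<in> p_multiples p 1"
  from add_in_p_multiples[OF this assms(2)] show False
    using of_nat_in_p_multiples_iff[OF p, of n] assms(1) by simp
qed

lemma reflect_inverse_square:
  assumes "0 < l" "l < p"
  shows "1 / (of_nat (p - l))\<^sup>2 - 1 / (of_nat l)\<^sup>2 \<in> p_multiples p 1"
proof (rule divide_cong_p_multiples[OF p])
  have "\<not> p dvd l" "\<not> p dvd p - l"
    using assms by (auto dest: dvd_imp_le)
  then show "(of_nat (p - l))\<^sup>2 \<notin> p_multiples p 1" "(of_nat l)\<^sup>2 \<notin> p_multiples p 1"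
    unfolding of_nat_power[symmetric] of_nat_in_p_multiples_iff[OF p] using p prime_dvd_power by blast+
  have "(of_nat (p - l))\<^sup>2 - (of_nat l)\<^sup>2 = (of_nat p ^ 1 * (of_nat p - 2 * of_nat l) :: rat)"
    using assms by (simp add: of_nat_diff power2_eq_square algebra_simps)
  then show "(of_nat (p - l))\<^sup>2 - (of_nat l)\<^sup>2 \<in> p_multiples p 1"
    by (rule p_multiplesI[rotated]) (simp add: rat_coprime_denom_closed)
qed (simp_all add: rat_coprime_denom_closed)

text \<open>Modulo \<open>p\<close> the full sum \<open>T\<close> is \<open>2 * H\<close> by pairing
  \<open>l\<close> with \<open>p - l\<close>, and \<open>H / 2\<close> by pairing each even number
  with its odd reflection. Thus \<open>3 * H / 2\<close> vanishes modulo \<open>p\<close>, and 3 is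
  invertible.\<close>

lemma half_sum_inverse_squares:
  assumes m: "p = 2 * m + 1" and "p \<noteq> 3"
  shows "(\<Sum>i<m. 1 / (of_nat i + 1)\<^sup>2) \<in> p_multiples p 1"
proof -
  define h :: "nat \<Rightarrow> rat" where "h l = 1 / (of_nat l)\<^sup>2" for l
  define H T where "H = (\<Sum>i<m. h (i + 1))" and "T = (\<Sum>i<2 * m. h (i + 1))"
  have "T - 2 * H = (\<Sum>i<m. h (p - (i + 1)) - h (i + 1))"
    using sum_lessThan_double_reflect[of h m] by (simp add: T_def H_def m sum_subtractf)
  also have "\<dots> \<in> p_multiples p 1"
    unfolding h_def using m by (intro sum_in_p_multiples reflect_inverse_square) auto
  finally have 1: "T - 2 * H \<in> p_multiples p 1" .
  have quarter: "h (2 * l) = h l / 4" for l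
    by (simp add: h_def power2_eq_square)
  have "T - H / 2 = (\<Sum>i<m. h (p - 2 * (i + 1)) - h (2 * (i + 1)))"
    unfolding T_def sum_lessThan_double_parity[of h m] quarter sum_subtractf
    by (simp add: H_def m sum_divide_distrib[symmetric])
  also have "\<dots> \<in> p_multiples p 1"
    unfolding h_def using m by (intro sum_in_p_multiples reflect_inverse_square) auto
  finally have 2: "T - H / 2 \<in> p_multiples p 1" .
  have "\<not> p dvd 3"
    using p \<open>p \<noteq> 3\<close> m prime_nat_iff by (auto dest!: dvd_imp_le prime_gt_1_nat)
  then have 3: "3 \<notin> p_multiples p 1"
    using of_nat_in_p_multiples_iff[OF p, of 3] by simp
  have "2 * ((T - H / 2) - (T - 2 * H)) / 3 \<in> p_multiples p 1"
    by (intro divide_in_p_multiples[OF p] mult_left_in_p_multiples diff_in_p_multiples 1 2 3) simp_all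
  then show ?thesis
    by (simp add: H_def h_def add.commute)
qed

lemma divide_power2_in_rat_coprime_denom:
  assumes "odd p" "x \<in> rat_coprime_denom p"
  shows "x / 2 ^ n \<in> rat_coprime_denom p"
proof (rule divide_in_rat_coprime_denom[OF p assms(2)])
  have "\<not> p dvd 2 ^ n"
    using p assms(1) by (metis prime_dvd_power primes_dvd_imp_eq two_is_prime_nat dvd_refl)
  then show "2 ^ n \<notin> p_multiples p 1"
    using of_nat_in_p_multiples_iff[OF p, of "2 ^ n"] by simp
qed (simp add: rat_coprime_denom_closed)

lemma long_supercongruence:
  assumes m: "p = 2 * m + 1" and "p \<noteq> 3"
  shows "(\<Sum>k\<le>m. (4 * of_nat k + 1) * (pochhammer (1 / 2) k / fact k) ^ 4) - of_nat p \<in> p_multiples p 4"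
proof -
  \<comment> \<open>The value that terminates the series at \<open>a = 1 / 2\<close>. It equals
    \<open>p^2 / 4\<close>, so it is also small at \<open>p\<close>.\<close>
  define X :: rat where "X = (1 / 2 + of_nat m)\<^sup>2"
  define V where "V Y j = (\<Prod>i<j. ((1 / 2 + of_nat i)\<^sup>2 - X) / ((of_nat i + 1)\<^sup>2 - Y))" for Y j
  have "m > 0"
    using p m by (cases m) auto
  have half: "x / 2 ^ n \<in> rat_coprime_denom p" if "x \<in> rat_coprime_denom p" for x n
    using m that by (intro divide_power2_in_rat_coprime_denom) auto
  have halfs: "1 / 2 \<in> rat_coprime_denom p" "1 / 4 \<in> rat_coprime_denom p"
    using half[of 1 1] half[of 1 2] by simp_all
  have Xp: "X = of_nat p ^ 2 * (1 / 4)"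
    by (simp add: X_def m power2_eq_square field_simps)
  then have X2: "X \<in> p_multiples p 2"
    using halfs by (intro p_multiplesI)
  have XI: "X \<in> rat_coprime_denom p" and X1: "X \<in> p_multiples p 1"
    using X2 p_multiples_subset[of p 2] p_multiples_mono[of 1 2 p] by auto
  have X1': "- X \<in> p_multiples p 1"
    using diff_in_p_multiples[OF zero_in_p_multiples X1] by simp
  \<comment> \<open>The index \<open>i = m\<close> is included because Whipple's transformation
    needs it; \<open>i + 1 < p\<close> still holds, as \<open>m > 0\<close>.\<close>
  have ndvd: "\<not> p dvd (i + 1) ^ n" if "i \<le> m" for i n
  proof
    assume "p dvd (i + 1) ^ n"
    then have "p dvd i + 1"
      using p prime_dvd_power by blast
    then show False
      using that \<open>m > 0\<close> m by (auto dest: dvd_imp_le)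
  qed
  have unit: "(of_nat i + 1) ^ n - Y \<notin> p_multiples p 1" if "i \<le> m" "Y \<in> p_multiples p 1" for i n Y
    using of_nat_diff_notin_p_multiples[OF ndvd[OF that(1), of n] that(2)] by (simp add: add.commute)
  have neq: "(of_nat i + 1)\<^sup>2 \<noteq> Y" if "i \<le> m" "Y \<in> p_multiples p 1" for i Y
    using unit[OF that, of 2] by auto
  have VI: "V Y j \<in> rat_coprime_denom p" if "j \<le> m" "Y \<in> p_multiples p 1" for Y j
  proof -
    have "Y \<in> rat_coprime_denom p"
      using that(2) p_multiples_subset by blast
    then show ?thesis
      unfolding V_def using that unit[OF _ that(2), of _ 2] XI halfs
      by (intro prod_in_rat_coprime_denom divide_in_rat_coprime_denom[OF p]) (auto intro!: rat_coprime_denom_closed)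
  qed
  \<comment> \<open>Only \<open>j = m\<close> gives the denominator \<open>p\<close>; the others are
    units.\<close>
  have oddI: "2 * of_nat j + 1 \<notin> p_multiples p 1" if "j < m" for j
  proof -
    have "\<not> p dvd 2 * j + 1"
      using that m by (auto dest: dvd_imp_le)
    then show ?thesis
      using of_nat_in_p_multiples_iff[OF p, of "2 * j + 1"] by (simp add: add.commute)
  qed

  have whipple: "(\<Sum>k\<le>m. (4 * of_nat k + 1) * (wp_prod (1 / 2) X k * wp_prod (1 / 2) (- X) k))
      = of_nat p ^ 2 * (\<Sum>j\<le>m. V (- X) j / (2 * of_nat j + 1))"
  proof -
    have nz: "1 / 2 + of_nat i \<noteq> (0::rat)" for i
      using of_nat_neq_0[of "2 * i", where ?'a = rat] by (auto simp: field_simps)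
    have "(\<Sum>k\<le>m. (2 * of_nat k + 1 / 2) * wp_prod (1 / 2) X k * wp_prod (1 / 2) (- X) k) =
      X / (1 / 2) * (\<Sum>j\<le>m. pochhammer (1 - 1 / 2) j / pochhammer (1 + 1 / 2) j * V (- X) j)"
      unfolding V_def using neq X1 X1' nz
      by (intro whipple_well_poised[OF X_def]) auto
    moreover have "pochhammer (1 - 1 / 2) j / pochhammer (1 + 1 / 2) j * V (- X) j = V (- X) j / (2 * of_nat j + 1)" for j
      using pochhammer_quot_shift_half[of j, where ?'a = rat] by simp
    \<comment> \<open>Doubling turns the prefactor \<open>X / (1 / 2)\<close> into
      \<open>4 * X\<close>, which is \<open>p^2\<close>.\<close>
    moreover have "(\<Sum>k\<le>m. (4 * of_nat k + 1) * (wp_prod (1 / 2) X k * wp_prod (1 / 2) (- X) k)) =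
      2 * (\<Sum>k\<le>m. (2 * of_nat k + 1 / 2) * wp_prod (1 / 2) X k * wp_prod (1 / 2) (- X) k)"
      by (simp add: sum_distrib_left algebra_simps)
    ultimately show ?thesis
      by (simp add: Xp)
  qed

  text \<open>The choice \<open>Y = -X\<close> cancels the terms of first order in \<open>X\<close>.\<close>
  have deform: "(\<Sum>k\<le>m. (4 * of_nat k + 1) * (wp_prod (1 / 2) X k * wp_prod (1 / 2) (- X) k)) -
      (\<Sum>k\<le>m. (4 * of_nat k + 1) * (pochhammer (1 / 2) k / fact k) ^ 4) \<in> p_multiples p 4"
    unfolding sum_subtractf[symmetric] right_diff_distrib[symmetric]
  proof (intro sum_in_p_multiples mult_left_in_p_multiples)
    fix k assume "k \<in> {..m}"
    have "X ^ 2 \<in> p_multiples p (2 + 2)"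
      unfolding power2_eq_square by (intro mult_in_p_multiples X2)
    then have X4: "X ^ 2 \<in> p_multiples p 4" by simp
    then have X41: "X ^ 2 \<in> p_multiples p 1"
      using p_multiples_mono[of 1 4 p] by auto
    have "wp_prod (1 / 2) X k * wp_prod (1 / 2) (- X) k =
        (\<Prod>i<k. ((1 / 2 + of_nat i) ^ 4 - X ^ 2) / ((of_nat i + 1) ^ 4 - X ^ 2))"
    proof -
      have sq: "(y\<^sup>2 - X) * (y\<^sup>2 - (- X)) = y ^ 4 - X\<^sup>2" for y
        by (simp add: algebra_simps power2_eq_square power4_eq_xxxx)
      show ?thesis
        unfolding wp_prod_def prod.distrib[symmetric] times_divide_times_eq sq ..
    qed
    moreover have "(pochhammer (1 / 2) k / fact k) ^ 4 = (\<Prod>i<k. (1 / 2 + of_nat i) ^ 4 / ((of_nat i + 1) ^ 4 - 0 :: rat))"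
      unfolding pochhammer_quot_eq_prod prod_power_distrib by (simp add: power_divide add.commute)
    moreover have "(\<Prod>i<k. ((1 / 2 + of_nat i) ^ 4 - X ^ 2) / ((of_nat i + 1) ^ 4 - X ^ 2)) -
        (\<Prod>i<k. (1 / 2 + of_nat i) ^ 4 / ((of_nat i + 1) ^ 4 - 0)) \<in> p_multiples p 4"
    proof (rule prod_cong_p_multiples)
      fix i assume "i \<in> {..<k}"
      with \<open>k \<in> {..m}\<close> have i: "i \<le> m" by simp
      have u: "(of_nat i + 1) ^ 4 - X ^ 2 \<notin> p_multiples p 1" "(of_nat i + 1) ^ 4 - 0 \<notin> p_multiples p 1"
        by (intro unit i X41 zero_in_p_multiples)+
      have I: "(of_nat i + 1) ^ 4 - X ^ 2 \<in> rat_coprime_denom p" "(of_nat i + 1) ^ 4 - 0 \<in> rat_coprime_denom p"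
        "(1 / 2 + of_nat i) ^ 4 - X ^ 2 \<in> rat_coprime_denom p" "(1 / 2 + of_nat i) ^ 4 \<in> rat_coprime_denom p"
        by (intro rat_coprime_denom_closed halfs XI of_nat_in_rat_coprime_denom one_in_rat_coprime_denom zero_in_rat_coprime_denom)+
      show "((1 / 2 + of_nat i) ^ 4 - X ^ 2) / ((of_nat i + 1) ^ 4 - X ^ 2) \<in> rat_coprime_denom p"
        "(1 / 2 + of_nat i) ^ 4 / ((of_nat i + 1) ^ 4 - 0) \<in> rat_coprime_denom p"
        by (intro divide_in_rat_coprime_denom[OF p] I u)+
      have "- (X ^ 2) \<in> p_multiples p 4"
        using diff_in_p_multiples[OF zero_in_p_multiples X4] by simp
      then have e: "(1 / 2 + of_nat i) ^ 4 - X ^ 2 - (1 / 2 + of_nat i) ^ 4 \<in> p_multiples p 4"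
        "(of_nat i + 1) ^ 4 - X ^ 2 - ((of_nat i + 1) ^ 4 - 0) \<in> p_multiples p 4"
        by simp_all
      show "((1 / 2 + of_nat i) ^ 4 - X ^ 2) / ((of_nat i + 1) ^ 4 - X ^ 2) -
          (1 / 2 + of_nat i) ^ 4 / ((of_nat i + 1) ^ 4 - 0) \<in> p_multiples p 4"
        by (rule divide_cong_p_multiples[OF p I(1) u(1) I(2) u(2) I(3) e])
    qed
    ultimately show "wp_prod (1 / 2) X k * wp_prod (1 / 2) (- X) k - (pochhammer (1 / 2) k / fact k) ^ 4 \<in> p_multiples p 4"
      by simp
  qed (auto intro!: rat_coprime_denom_closed)

  \<comment> \<open>The denominators change by \<open>X\<close>, a multiple of \<open>p^2\<close>.
    Together with the prefactor \<open>p^2\<close> this suffices whenever \<open>2j + 1\<close> is a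
    unit.\<close>
  have low: "V (- X) j - V 0 j \<in> p_multiples p 2" if "j < m" for j
    unfolding V_def
  proof (rule prod_cong_p_multiples)
    fix i assume "i \<in> {..<j}"
    with that have i: "i \<le> m" by simp
    have u: "(of_nat i + 1)\<^sup>2 - (- X) \<notin> p_multiples p 1" "(of_nat i + 1)\<^sup>2 - 0 \<notin> p_multiples p 1"
      by (intro unit i X1' zero_in_p_multiples)+
    have I: "(of_nat i + 1)\<^sup>2 - (- X) \<in> rat_coprime_denom p" "(of_nat i + 1)\<^sup>2 - 0 \<in> rat_coprime_denom p"
      "(1 / 2 + of_nat i)\<^sup>2 - X \<in> rat_coprime_denom p"
      by (intro rat_coprime_denom_closed halfs XI of_nat_in_rat_coprime_denom one_in_rat_coprime_denom zero_in_rat_coprime_denom)+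
    show "((1 / 2 + of_nat i)\<^sup>2 - X) / ((of_nat i + 1)\<^sup>2 - - X) \<in> rat_coprime_denom p"
      "((1 / 2 + of_nat i)\<^sup>2 - X) / ((of_nat i + 1)\<^sup>2 - 0) \<in> rat_coprime_denom p"
      by (intro divide_in_rat_coprime_denom[OF p] I u)+
    show "((1 / 2 + of_nat i)\<^sup>2 - X) / ((of_nat i + 1)\<^sup>2 - - X) -
        ((1 / 2 + of_nat i)\<^sup>2 - X) / ((of_nat i + 1)\<^sup>2 - 0) \<in> p_multiples p 2"
      using X2 by (intro divide_cong_p_multiples[OF p I(1) u(1) I(2) u(2) I(3)]) simp_all
  qed

  \<comment> \<open>Here the division by \<open>2m + 1 = p\<close> costs one power, so one more
    power of \<open>p\<close> is needed than in \<open>low\<close>.\<close>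
  have top: "V (- X) m - V 0 m \<in> p_multiples p 3"
  proof -
    define c :: "nat \<Rightarrow> rat" where "c i = 1 / (of_nat i + 1)\<^sup>2" for i
    have cI: "c i \<in> rat_coprime_denom p" if "i < m" for i
      unfolding c_def using unit[of i 0 2] that
      by (intro divide_in_rat_coprime_denom[OF p]) (auto intro!: rat_coprime_denom_closed)
    \<comment> \<open>Each factor is \<open>((i + 1)^2 + X) / (i + 1)^2\<close>, so \<open>P\<close>
      carries \<open>V (- X) m\<close> to \<open>V 0 m\<close>. Its first-order term is
      \<open>X\<close> times the sum of inverse squares, which supplies the third power of
      \<open>p\<close>.\<close>
    define P where "P = (\<Prod>i<m. 1 + X * c i)"
    have "P - 1 - X * sum c {..<m} \<in> p_multiples p (2 + 2)"
      unfolding P_def using X2 cI by (intro prod_one_plus_cong) auto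
    then have "P - 1 - X * sum c {..<m} \<in> p_multiples p 3"
      using p_multiples_mono[of 3 4 p] by auto
    moreover have "X * sum c {..<m} \<in> p_multiples p (2 + 1)"
      unfolding c_def using m \<open>p \<noteq> 3\<close> by (intro mult_in_p_multiples X2 half_sum_inverse_squares)
    ultimately have "P - 1 \<in> p_multiples p 3"
      using add_in_p_multiples by fastforce
    moreover have "V 0 m = V (- X) m * P"
      unfolding V_def P_def prod.distrib[symmetric]
    proof (rule prod.cong)
      fix i assume "i \<in> {..<m}"
      then show "((1 / 2 + of_nat i)\<^sup>2 - X) / ((of_nat i + 1)\<^sup>2 - 0) =
          ((1 / 2 + of_nat i)\<^sup>2 - X) / ((of_nat i + 1)\<^sup>2 - - X) * (1 + X * c i)"
        using neq[of i 0] neq[of i "- X"] X1' by (simp add: c_def divide_simps add_eq_0_iff)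
    qed simp
    then have "V (- X) m - V 0 m = - V (- X) m * (P - 1)"
      by (simp add: algebra_simps)
    ultimately show ?thesis
      using VI[OF order_refl X1'] by (simp add: mult_left_in_p_multiples uminus_in_rat_coprime_denom del: mult_minus_left)
  qed

  have "of_nat p ^ 2 * (\<Sum>j\<le>m. V (- X) j / (2 * of_nat j + 1)) - of_nat p \<in> p_multiples p 4"
  proof -
    have "p > 0" using m by simp
    \<comment> \<open>Multiplied by \<open>p^2\<close> this is exactly \<open>p\<close>, so only the
      passage from \<open>V 0\<close> to \<open>V (- X)\<close> contributes an error.\<close>
    have "(\<Sum>j\<le>m. V 0 j / (2 * of_nat j + 1)) = 1 / of_nat p"
      using saalschuetz_half[OF X_def] by (simp add: V_def m)
    then have "of_nat p = of_nat p ^ 2 * (\<Sum>j\<le>m. V 0 j / (2 * of_nat j + 1))"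
      using \<open>p > 0\<close> by (simp add: power2_eq_square)
    then have "of_nat p ^ 2 * (\<Sum>j\<le>m. V (- X) j / (2 * of_nat j + 1)) - of_nat p =
        of_nat p ^ 2 * ((\<Sum>j\<le>m. V (- X) j / (2 * of_nat j + 1)) - (\<Sum>j\<le>m. V 0 j / (2 * of_nat j + 1)))"
      by (simp add: right_diff_distrib)
    also have "\<dots> = of_nat p ^ 2 * (\<Sum>j\<le>m. (V (- X) j - V 0 j) / (2 * of_nat j + 1))"
      by (simp only: sum_subtractf diff_divide_distrib)
    also have "\<dots> = of_nat p ^ 2 * (\<Sum>j<m. (V (- X) j - V 0 j) / (2 * of_nat j + 1)) +
        of_nat p ^ 2 * ((V (- X) m - V 0 m) / of_nat p)"
      by (simp only: lessThan_Suc_atMost[symmetric] sum.lessThan_Suc distrib_left) (simp add: m)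
    also have "\<dots> = of_nat p ^ 2 * (\<Sum>j<m. (V (- X) j - V 0 j) / (2 * of_nat j + 1)) +
        of_nat p ^ 1 * (V (- X) m - V 0 m)"
      using \<open>p > 0\<close> by (simp add: power2_eq_square)
    also have "\<dots> \<in> p_multiples p 4"
    proof (rule add_in_p_multiples)
      have "of_nat p ^ 2 * (\<Sum>j<m. (V (- X) j - V 0 j) / (2 * of_nat j + 1)) \<in> p_multiples p (2 + 2)"
        by (intro mult_in_p_multiples power_p_in_p_multiples sum_in_p_multiples divide_in_p_multiples[OF p] low oddI)
          (auto intro!: rat_coprime_denom_closed)
      then show "of_nat p ^ 2 * (\<Sum>j<m. (V (- X) j - V 0 j) / (2 * of_nat j + 1)) \<in> p_multiples p 4"
        by simp
      have "of_nat p ^ 1 * (V (- X) m - V 0 m) \<in> p_multiples p (1 + 3)"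
        by (intro mult_in_p_multiples power_p_in_p_multiples top)
      then show "of_nat p ^ 1 * (V (- X) m - V 0 m) \<in> p_multiples p 4"
        by simp
    qed
    finally show ?thesis .
  qed
  from diff_in_p_multiples[OF this deform] show ?thesis
    unfolding whipple by simp
qed

end

section \<open>The sums of odd powers\<close>

text \<open>Both sides are twice \<open>(-1/2)_(k+1)\<close>, split at its last or at its first
  factor. Fourth powers remove the sign.\<close>

lemma pochhammer_minus_half:
  "(2 * of_nat k - 1) * pochhammer (- 1 / 2) k = - pochhammer (1 / 2 :: 'a::field_char_0) k"
proof (induction k)
  case (Suc k)
  have "(2 * of_nat (Suc k) - 1) * pochhammer (- 1 / 2) (Suc k)
      = ((2 * of_nat k - 1) * pochhammer (- 1 / 2 :: 'a) k) * (1 / 2 + of_nat k)"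
    by (simp add: pochhammer_Suc field_simps)
  then show ?case
    unfolding Suc by (simp add: pochhammer_Suc)
qed simp

context
  fixes p n :: nat
  assumes p: "prime p" and n: "p + 1 = 2 * n"
begin

lemma half_closed: "x \<in> rat_coprime_denom p \<Longrightarrow> x / 2 ^ i \<in> rat_coprime_denom p"
  using n by (intro divide_power2_in_rat_coprime_denom[OF p]) presburger+

lemma weight_closed:
  assumes "k \<le> n"
  shows "weight k \<in> rat_coprime_denom p"
proof -
  have "(- 1 / 2 + of_nat i) / (1 + of_nat i) \<in> rat_coprime_denom p" if "i < k" for i
  proof (rule divide_in_rat_coprime_denom[OF p])
    have "- 1 / 2 \<in> rat_coprime_denom p"
      using half_closed[of "- 1" 1] by (simp add: rat_coprime_denom_closed)
    then show "- 1 / 2 + of_nat i \<in> rat_coprime_denom p"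
      by (intro rat_coprime_denom_closed of_nat_in_rat_coprime_denom)
    have "\<not> p dvd i + 1"
      using that assms n prime_gt_1_nat[OF p] by (auto dest!: dvd_imp_le)
    then show "1 + of_nat i \<notin> p_multiples p 1"
      using of_nat_in_p_multiples_iff[OF p, of "i + 1"] by (simp add: add.commute)
  qed (simp add: rat_coprime_denom_closed)
  then show ?thesis
    unfolding weight_def power_divide[symmetric] pochhammer_quot_eq_prod
    by (intro rat_coprime_denom_closed prod_in_rat_coprime_denom) simp
qed

text \<open>The upper limit gives \<open>4n - 2 = 2p\<close>, so the boundary term of
  \<open>telescope_weight\<close> carries the factor \<open>p^4\<close>.\<close>

lemma last_term_in_p_multiples:
  assumes "Q \<in> rat_coprime_denom p"
  shows "(4 * of_nat n - 2) ^ 4 * Q * weight n \<in> p_multiples p 4"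
proof -
  have "4 * of_nat n - 2 = (2 * of_nat p :: rat)"
    using arg_cong[OF n, of "of_nat :: nat \<Rightarrow> rat"] by simp
  then have "(4 * of_nat n - 2) ^ 4 * Q * weight n = of_nat p ^ 4 * (2 ^ 4 * Q * weight n)"
    by (simp only: power_mult_distrib mult_ac)
  moreover have "2 ^ 4 * Q * weight n \<in> rat_coprime_denom p"
    using assms by (intro rat_coprime_denom_closed weight_closed) simp_all
  ultimately show ?thesis
    by (rule p_multiplesI[rotated])
qed

text \<open>\<open>telescope_weight\<close> in the variable \<open>x = 4k - 1\<close>. In this
  variable an even \<open>q\<close> yields an odd \<open>f\<close>, which suits sums of odd
  powers.\<close>

lemma telescoping_sum_in_p_multiples:
  assumes "\<And>x. f x = (x - 1) ^ 4 * q (x + 2) - (x + 1) ^ 4 * q (x - 2)"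
    and "q (4 * of_nat n + 1) \<in> rat_coprime_denom p"
  shows "(\<Sum>k\<le>n. f (4 * of_nat k - 1) * weight k) \<in> p_multiples p 4"
proof -
  have "f (4 * of_nat k - 1) =
      (4 * of_nat k - 2) ^ 4 * q (4 * of_nat k + 1) - (4 * of_nat k) ^ 4 * q (4 * of_nat k - 3)" for k
  proof -
    have "4 * of_nat k - 1 - 1 = (4 * of_nat k - 2 :: rat)" "4 * of_nat k - 1 + 2 = (4 * of_nat k + 1 :: rat)"
      "4 * of_nat k - 1 + 1 = (4 * of_nat k :: rat)" "4 * of_nat k - 1 - 2 = (4 * of_nat k - 3 :: rat)"
      by simp_all
    then show ?thesis
      by (simp only: assms(1))
  qed
  then have "(\<Sum>k\<le>n. f (4 * of_nat k - 1) * weight k) = (4 * of_nat n - 2) ^ 4 * q (4 * of_nat n + 1) * weight n"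
    using telescope_weight[of q n] by simp
  then show ?thesis
    using last_term_in_p_multiples[OF assms(2)] by simp
qed

lemma cubic_sum: "(\<Sum>k\<le>n. (4 * of_nat k - 1) ^ 3 * weight k) \<in> p_multiples p 4"
proof (rule telescoping_sum_in_p_multiples)
  \<comment> \<open>For \<open>q t = t^2\<close> the difference is \<open>8x^3 - 24x\<close>, for
    \<open>q t = 1\<close> it is \<open>-8x^3 - 8x\<close>; \<open>t^2 - 3\<close> removes the
    linear term and leaves \<open>32x^3\<close>.\<close>
  show "x ^ 3 = (x - 1) ^ 4 * (((x + 2) ^ 2 - 3) / 2 ^ 5) - (x + 1) ^ 4 * (((x - 2) ^ 2 - 3) / 2 ^ 5)" for x :: rat
    by (simp add: field_simps eval_nat_numeral)
qed (intro half_closed, simp add: rat_coprime_denom_closed)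

lemma quintic_sum:
  assumes "p \<noteq> 3"
  shows "(\<Sum>k\<le>n. (4 * of_nat k - 1) ^ 5 * weight k) - 16 * of_nat p \<in> p_multiples p 4"
proof -
  obtain m where nm: "n = Suc m"
    using n by (cases n) auto
  define L :: rat where "L = (\<Sum>k\<le>m. (4 * of_nat k + 1) * (pochhammer (1 / 2) k / fact k) ^ 4)"
  have "(\<Sum>k\<le>n. ((4 * of_nat k - 1) ^ 5 - (4 * of_nat k - 1 - 1) ^ 4 * (4 * of_nat k - 1 + 2)) * weight k) \<in> p_multiples p 4"
  proof (rule telescoping_sum_in_p_multiples)
    \<comment> \<open>The term \<open>16t\<close> of \<open>q\<close> accounts for the even powers
      on the left, and \<open>5t^2 + 13\<close> for the odd part \<open>2x^3 + 7x\<close>.\<close>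
    show "x ^ 5 - (x - 1) ^ 4 * (x + 2) =
        (x - 1) ^ 4 * (- (5 * (x + 2) ^ 2 + 16 * (x + 2) + 13) / 2 ^ 5) -
        (x + 1) ^ 4 * (- (5 * (x - 2) ^ 2 + 16 * (x - 2) + 13) / 2 ^ 5)" for x :: rat
      by (simp add: field_simps eval_nat_numeral)
  qed (intro half_closed, simp add: rat_coprime_denom_closed del: minus_add_distrib)
  \<comment> \<open>As \<open>x - 1 = 2 * (2k - 1)\<close>, the factor \<open>(x - 1)^4\<close>
    turns \<open>(-1/2)_k^4\<close> into \<open>16 (1/2)_k^4\<close>. The range of \<open>L\<close>
    ends at \<open>m = n - 1\<close>, so the term \<open>k = n\<close> is kept apart; it is a
    multiple of \<open>p^4\<close>.\<close>
  moreover have "(\<Sum>k\<le>n. (4 * of_nat k - 1 - 1) ^ 4 * (4 * of_nat k - 1 + 2) * weight k)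
      = 16 * L + (4 * of_nat n - 2) ^ 4 * (4 * of_nat n + 1) * weight n"
  proof -
    have "(4 * of_nat k - 1 - 1) ^ 4 * (4 * of_nat k - 1 + 2) * weight k =
        16 * ((4 * of_nat k + 1) * (pochhammer (1 / 2) k / fact k) ^ 4)" for k
    proof -
      have "(4 * of_nat k - 1 - 1) ^ 4 * (4 * of_nat k - 1 + 2) * weight k
          = 16 * ((4 * of_nat k + 1) * (((2 * of_nat k - 1) * pochhammer (- 1 / 2) k) ^ 4 / fact k ^ 4))"
      proof -
        have "4 * of_nat k - 1 - 1 = (2 * (2 * of_nat k - 1) :: rat)" "4 * of_nat k - 1 + 2 = (4 * of_nat k + 1 :: rat)"
          by simp_all
        then show ?thesis
          by (simp only: weight_def power_mult_distrib) simp
      qed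
      then show ?thesis
        unfolding pochhammer_minus_half by (simp add: power_divide)
    qed
    then have "(\<Sum>k\<le>m. (4 * of_nat k - 1 - 1) ^ 4 * (4 * of_nat k - 1 + 2) * weight k) = 16 * L"
      by (simp only: L_def sum_distrib_left)
    then show ?thesis
      by (simp add: nm)
  qed
  ultimately have "(\<Sum>k\<le>n. (4 * of_nat k - 1) ^ 5 * weight k)
      - (16 * L + (4 * of_nat n - 2) ^ 4 * (4 * of_nat n + 1) * weight n) \<in> p_multiples p 4"
    unfolding left_diff_distrib sum_subtractf by simp
  from add_in_p_multiples[OF this last_term_in_p_multiples[of "4 * of_nat n + 1"]]
  have "(\<Sum>k\<le>n. (4 * of_nat k - 1) ^ 5 * weight k) - 16 * L \<in> p_multiples p 4"
    by (simp add: rat_coprime_denom_closed)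
  moreover have "L - of_nat p \<in> p_multiples p 4"
    unfolding L_def using n nm assms by (intro long_supercongruence[OF p]) auto
  ultimately have "((\<Sum>k\<le>n. (4 * of_nat k - 1) ^ 5 * weight k) - 16 * L) + 16 * (L - of_nat p) \<in> p_multiples p 4"
    by (intro add_in_p_multiples mult_left_in_p_multiples) simp_all
  then show ?thesis
    by (simp add: algebra_simps)
qed

lemma septic_sum:
  assumes "p \<noteq> 3"
  shows "(\<Sum>k\<le>n. (4 * of_nat k - 1) ^ 7 * weight k) - 80 * of_nat p \<in> p_multiples p 4"
proof -
  define S where "S r = (\<Sum>k\<le>n. (4 * of_nat k - 1) ^ r * weight k)" for r :: nat
  have "(\<Sum>k\<le>n. ((4 * of_nat k - 1) ^ 7 - 5 * (4 * of_nat k - 1) ^ 5) * weight k) \<in> p_multiples p 4"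
  proof (rule telescoping_sum_in_p_multiples)
    \<comment> \<open>For \<open>q t = t^4\<close> the difference is
      \<open>8x^7 - 40x^5 + 80x^3 - 64x\<close>, which fixes the ratio 5; the terms in
      \<open>t^2\<close> and 1 cancel the cubic and linear parts.\<close>
    show "x ^ 7 - 5 * x ^ 5 =
        (x - 1) ^ 4 * ((2 * (x + 2) ^ 4 - 9 * (x + 2) ^ 2 + 11) / 2 ^ 4) -
        (x + 1) ^ 4 * ((2 * (x - 2) ^ 4 - 9 * (x - 2) ^ 2 + 11) / 2 ^ 4)" for x :: rat
      by (simp add: field_simps eval_nat_numeral)
  qed (intro half_closed, simp add: rat_coprime_denom_closed)
  moreover have "(\<Sum>k\<le>n. ((4 * of_nat k - 1) ^ 7 - 5 * (4 * of_nat k - 1) ^ 5) * weight k) = S 7 - 5 * S 5"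
    by (simp only: S_def sum_subtractf left_diff_distrib sum_distrib_left mult.assoc)
  ultimately have "(S 7 - 5 * S 5) + 5 * (S 5 - 16 * of_nat p) \<in> p_multiples p 4"
    using quintic_sum[OF assms] by (intro add_in_p_multiples mult_left_in_p_multiples) (simp_all add: S_def)
  then show ?thesis
    by (simp add: S_def algebra_simps)
qed

lemma power_sum_closed: "(\<Sum>k\<le>n. (4 * of_nat k - 1) ^ r * weight k) \<in> rat_coprime_denom p"
proof -
  have "(\<Sum>k\<le>n. (4 * of_nat k - 1) ^ r * weight k) \<in> p_multiples p 0"
    by (intro sum_in_p_multiples) (simp add: rat_coprime_denom_closed weight_closed)
  then show ?thesis by simp
qed

end

theorem theorem1p3:
  fixes p :: nat
  assumes "prime p" and "odd p"
  shows "rat_cong p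
           (\<Sum>k = 0..(p + 1) div 2. (4 * of_nat k - 1) ^ 3 * (pochhammer (- 1 / 2) k ^ 4 / fact k ^ 4))
           0 (p ^ 4) \<and>
         (p \<noteq> 3 \<longrightarrow> rat_cong p
           (\<Sum>k = 0..(p + 1) div 2. (4 * of_nat k - 1) ^ 5 * (pochhammer (- 1 / 2) k ^ 4 / fact k ^ 4))
           (16 * of_nat p) (p ^ 4)) \<and>
         (p \<noteq> 3 \<longrightarrow> rat_cong p
           (\<Sum>k = 0..(p + 1) div 2. (4 * of_nat k - 1) ^ 7 * (pochhammer (- 1 / 2) k ^ 4 / fact k ^ 4))
           (80 * of_nat p) (p ^ 4))"
proof -
  have n: "p + 1 = 2 * ((p + 1) div 2)"
    using \<open>odd p\<close> by simp
  show ?thesis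
    unfolding rat_cong_iff atLeast0AtMost weight_def[symmetric]
    using cubic_sum[OF \<open>prime p\<close> n] quintic_sum[OF \<open>prime p\<close> n] septic_sum[OF \<open>prime p\<close> n]
      power_sum_closed[OF \<open>prime p\<close> n]
    by (simp add: mult_in_rat_coprime_denom)
qed

end
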